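(* For any nonempty subset $Q$ of a real vector space $X$ the equalities $$Q^{\infty}=\bigcap\{S^{\infty} : S\in\sigma^+(Q)\}=-\bigcap\{C^{\infty} : C\in\sigma^-(Q)\}$$ hold.
   Context: For a subset $Q\subset X$, a vector $y\in X$ defines a recession direction for $Q$ if $x+ty\in Q$ for all $x\in Q$ and all $t\in[0,+\infty)$; $Q^{\infty}$ denotes the set of all vectors defining recession directions for $Q$. In particular $\varnothing^{\infty}=X$ and $X^\infty=X$. $\sigma^+(Q)$ is the family of all convex components of $Q$, i.e. all maximal (with respect to inclusion) nonempty convex subsets of $Q$. $\sigma^-(Q)$ is the family of all convex complements of $Q$, i.e. all maximal (with respect to inclusion) convex subsets $D\subset X$ with $D\cap Q=\varnothing$. For a set $A\subset X$, $-A=\{-a: a\in A\}$. *)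

theory Defs
  imports "HOL-Analysis.Analysis"
begin

definition recession_directions :: "'a::real_vector set \<Rightarrow> 'a set" where
  "recession_directions Q = {y. \<forall>x\<in>Q. \<forall>t\<ge>0. x + t *\<^sub>R y \<in> Q}"

definition convex_components :: "'a::real_vector set \<Rightarrow> 'a set set" where
  "convex_components Q =
     {S. S \<noteq> {} \<and> convex S \<and> S \<subseteq> Q \<and>
         (\<forall>T. T \<noteq> {} \<and> convex T \<and> T \<subseteq> Q \<and> S \<subseteq> T \<longrightarrow> T = S)}"

text \<open>Unlike a convex component, a convex complement may be empty; for \<open>Q = UNIV\<close> the empty
  set is the only one.\<close>

definition convex_complements :: "'a::real_vector set \<Rightarrow> 'a set set" where
  "convex_complements Q =
     {D. convex D \<and> D \<inter> Q = {} \<and>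
         (\<forall>T. convex T \<and> T \<inter> Q = {} \<and> D \<subseteq> T \<longrightarrow> T = D)}"

end

theory Submission
  imports Defs
begin

text \<open>Adding a ray in a recession direction of \<open>Q\<close> to a convex subset of \<open>Q\<close> gives a larger
  convex subset of \<open>Q\<close>, so a convex component absorbs it; conversely the components cover \<open>Q\<close>
  by Zorn's lemma. This yields the first equality for every \<open>Q\<close>, including the empty set. The
  second equality is the first one for the complement of \<open>Q\<close>: its components are the nonempty
  convex complements of \<open>Q\<close>, and passing to the complement negates the recession directions.\<close>

lemma recession_directionsD:
  "y \<in> recession_directions Q \<Longrightarrow> x \<in> Q \<Longrightarrow> 0 \<le> t \<Longrightarrow> x + t *\<^sub>R y \<in> Q"
  by (simp add: recession_directions_def)

lemma recession_directions_empty [simp]: "recession_directions {} = UNIV"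
  by (simp add: recession_directions_def)

lemma convex_Union_chain:
  assumes "subset.chain {T. convex T} C"
  shows "convex (\<Union>C)"
proof (rule convexI)
  fix a b and u v :: real
  assume "a \<in> \<Union>C" "b \<in> \<Union>C" and uv: "0 \<le> u" "0 \<le> v" "u + v = 1"
  then obtain A B where "A \<in> C" "a \<in> A" "B \<in> C" "b \<in> B"
    by blast
  moreover from this assms have "A \<subseteq> B \<or> B \<subseteq> A"
    by (auto simp: subset_chain_def)
  ultimately obtain D where "D \<in> C" "a \<in> D" "b \<in> D"
    by blast
  moreover from this assms have "convex D"
    by (auto simp: subset_chain_def)
  ultimately show "u *\<^sub>R a + v *\<^sub>R b \<in> \<Union>C"
    using uv by (blast dest: convexD)
qed

lemma convex_component_exists:
  assumes "x \<in> Q"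
  obtains S where "S \<in> convex_components Q" "x \<in> S"
proof -
  let ?F = "{T. convex T \<and> x \<in> T \<and> T \<subseteq> Q}"
  have "\<exists>M\<in>?F. \<forall>T\<in>?F. M \<subseteq> T \<longrightarrow> T = M"
  proof (rule subset_Zorn_nonempty)
    show "?F \<noteq> {}"
      using assms by (auto intro!: exI[of _ "{x}"])
  next
    fix C assume "C \<noteq> {}" and C: "subset.chain ?F C"
    moreover from C have "convex (\<Union>C)"
      by (intro convex_Union_chain) (auto simp: subset_chain_def)
    \<comment> \<open>\<open>C \<noteq> {}\<close> is what puts \<open>x\<close> into the
      union.\<close>
    ultimately show "\<Union>C \<in> ?F"
      by (fastforce simp: subset_chain_def)
  qed
  then obtain M where "M \<in> ?F" and M: "\<forall>T\<in>?F. M \<subseteq> T \<longrightarrow> T = M"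
    by blast
  \<comment> \<open>A convex subset of \<open>Q\<close> that includes \<open>M\<close> also contains
    \<open>x\<close>, so it lies in \<open>?F\<close>; maximality in \<open>?F\<close> is thus
    maximality among all convex subsets of \<open>Q\<close>.\<close>
  then have "M \<in> convex_components Q"
    by (auto simp: convex_components_def)
  with \<open>M \<in> ?F\<close> show thesis
    using that by blast
qed

lemma recession_directions_convex_component:
  assumes S: "S \<in> convex_components Q" and y: "y \<in> recession_directions Q"
  shows "y \<in> recession_directions S"
proof -
  \<comment> \<open>\<open>?R\<close> is the ray spanned by \<open>y\<close> and \<open>?T\<close>
    the Minkowski sum of \<open>S\<close> and \<open>?R\<close>, written in the form that
    \<open>convex_sums\<close> expects.\<close>
  let ?R = "(\<lambda>t. t *\<^sub>R y) ` {0..}"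
  let ?T = "\<Union>x\<in>S. \<Union>z\<in>?R. {x + z}"
  have "linear (\<lambda>t. t *\<^sub>R y)"
    by (simp add: linear_iff scaleR_left_distrib)
  then have "convex ?R"
    by (intro convex_linear_image convex_real_interval)
  moreover have "convex S" "S \<noteq> {}" "S \<subseteq> Q"
    and max: "\<And>T. T \<noteq> {} \<Longrightarrow> convex T \<Longrightarrow> T \<subseteq> Q \<Longrightarrow> S \<subseteq> T \<Longrightarrow> T = S"
    using S by (auto simp: convex_components_def)
  ultimately have "convex ?T"
    by (intro convex_sums)
  moreover have "S \<subseteq> ?T"
    by (force intro: bexI[of _ 0])
  moreover have "?T \<subseteq> Q"
    using \<open>S \<subseteq> Q\<close> recession_directionsD[OF y] by auto
  ultimately have "?T = S"
    using \<open>S \<noteq> {}\<close> by (intro max) auto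
  then show ?thesis
    by (auto simp: recession_directions_def)
qed

lemma recession_directions_eq_INT_components:
  "recession_directions Q = (\<Inter>S\<in>convex_components Q. recession_directions S)"
proof (intro equalityI subsetI)
  fix y assume "y \<in> recession_directions Q"
  then show "y \<in> (\<Inter>S\<in>convex_components Q. recession_directions S)"
    by (simp add: recession_directions_convex_component)
next
  fix y assume y: "y \<in> (\<Inter>S\<in>convex_components Q. recession_directions S)"
  have "x + t *\<^sub>R y \<in> Q" if "x \<in> Q" "0 \<le> t" for x t
  proof -
    obtain S where S: "S \<in> convex_components Q" "x \<in> S"
      using convex_component_exists[OF \<open>x \<in> Q\<close>] .
    with y \<open>0 \<le> t\<close> have "x + t *\<^sub>R y \<in> S"
      by (auto intro: recession_directionsD)
    with S show ?thesis
      by (auto simp: convex_components_def)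
  qed
  then show "y \<in> recession_directions Q"
    by (simp add: recession_directions_def)
qed

text \<open>Disjointness from \<open>Q\<close> is inclusion in \<open>- Q\<close>, and supersets of
  a nonempty set are nonempty, so both maximality conditions agree on nonempty sets.\<close>

lemma convex_components_Compl:
  "convex_components (- Q) = convex_complements Q - {{}}"
  unfolding convex_components_def convex_complements_def
  by (auto simp: disjoint_eq_subset_Compl)

text \<open>If the empty set is a convex complement, it contributes only \<open>UNIV\<close> to the
  intersection, so discarding it changes nothing.\<close>

lemma INT_convex_complements:
  "(\<Inter>C\<in>convex_complements Q. recession_directions C) = recession_directions (- Q)"
  unfolding recession_directions_eq_INT_components[of "- Q"] convex_components_Compl
  by auto

text \<open>If moving from \<open>x\<close> along \<open>- y\<close> entered \<open>Q\<close>,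
  moving back along \<open>y\<close> would stay in \<open>Q\<close> and end at
  \<open>x\<close>.\<close>

lemma uminus_in_recession_directions_Compl:
  assumes "y \<in> recession_directions Q"
  shows "- y \<in> recession_directions (- Q)"
proof -
  have "x + t *\<^sub>R (- y) \<notin> Q" if "x \<notin> Q" "0 \<le> t" for x t
    using recession_directionsD[OF assms, of "x + t *\<^sub>R (- y)" t] that by auto
  then show ?thesis
    by (simp add: recession_directions_def)
qed

text \<open>Both inclusions come from the previous lemma, applied to \<open>Q\<close> and to
  \<open>- Q\<close>, as complement and negation are involutions.\<close>

lemma recession_directions_Compl:
  "recession_directions Q = uminus ` recession_directions (- Q)"
proof (intro equalityI subsetI)
  fix y assume "y \<in> recession_directions Q"
  then show "y \<in> uminus ` recession_directions (- Q)"
    by (intro image_eqI[of _ _ "- y"]) (simp_all add: uminus_in_recession_directions_Compl)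
next
  fix y assume "y \<in> uminus ` recession_directions (- Q)"
  then show "y \<in> recession_directions Q"
    using uminus_in_recession_directions_Compl[of _ "- Q"] by auto
qed

theorem theorem2p3:
  fixes Q :: "'a::real_vector set"
  assumes "Q \<noteq> {}"
  shows "recession_directions Q = (\<Inter>S\<in>convex_components Q. recession_directions S) \<and>
         (\<Inter>S\<in>convex_components Q. recession_directions S) =
           uminus ` (\<Inter>C\<in>convex_complements Q. recession_directions C)"
  using recession_directions_eq_INT_components[of Q] recession_directions_Compl[of Q]
  by (simp add: INT_convex_complements)

end
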